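(* Let $X$ be a Hausdorff locally convex topological vector space, let $K$ be a nonempty convex compact subset of $X$, let $D\subseteq K$ be a self segment-dense set in $K$, and let $\varphi:K\times K\to\mathbb{R}$ be a function satisfying: (i) for all $y\in D$, the function $x\mapsto\varphi(x,y)$ is upper semicontinuous on $K$; (ii) for all $x\in K$, the function $y\mapsto\varphi(x,y)$ is upper semicontinuous on $K\setminus D$; (iii) for all $x\in D$, the function $y\mapsto\varphi(x,y)$ is convex on $D$; (iv) for all $x\in D$, $\varphi(x,x)\ge0$. Then there exists $x_0\in K$ such that $\varphi(x_0,y)\ge0$ for all $y\in K$.
   Context: Self segment-dense: for $U\subseteq V\subseteq X$ with $V$ convex, $U$ is self segment-dense in $V$ if $U$ is dense in $V$ (i.e. $V\subseteq\operatorname{cl}(U)$) and for all $x,y\in U$ the set $[x,y]\cap U$ is dense in the closed segment $[x,y]=\{x+t(y-x):t\in[0,1]\}$. A function on $K$ is upper semicontinuous on $S\subseteq K$ if, as a function on $K$, it is upper semicontinuous at each point of $S$. A real function $f$ is convex on a (not necessarily convex) set $D$ if for all $x_1,\dots,x_n\in D$ and $\lambda_i\ge0$ with $\sum_{i=1}^n\lambda_i=1$ and $\sum_{i=1}^n\lambda_ix_i\in D$ one has $\sum_{i=1}^n\lambda_if(x_i)\ge f\left(\sum_{i=1}^n\lambda_ix_i\right)$. *)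

theory Defs
  imports "HOL-Analysis.Analysis"
begin

text \<open>
  Vectors live in a whole type \<open>'a\<close>. The Hausdorff property is not built into the two classes
  below; it is added separately through the sort \<^class>\<open>t2_space\<close>.
\<close>

class real_topological_vector = real_vector + topological_ab_group_add +
  assumes tendsto_scaleR_Pair:
    "LIM p (nhds r \<times>\<^sub>F nhds a). fst p *\<^sub>R snd p :> nhds (r *\<^sub>R a)"

class real_locally_convex = real_topological_vector +
  assumes convex_nhds_zero_base:
    "open U \<Longrightarrow> 0 \<in> U \<Longrightarrow>
       \<exists>V W. (\<forall>x\<in>V. \<forall>y\<in>V. \<forall>u\<ge>0. \<forall>v\<ge>0. u + v = 1 \<longrightarrow> u *\<^sub>R x + v *\<^sub>R y \<in> V) \<and>
             open W \<and> 0 \<in> W \<and> W \<subseteq> V \<and> V \<subseteq> U"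

text \<open>
  The class axiom has to unfold \<^const>\<open>convex\<close>, whose sort constraint is not accepted inside the
  class specification.
\<close>

lemma convex_nhds_zeroE:
  fixes U :: "'a::real_locally_convex set"
  assumes "open U" "0 \<in> U"
  obtains V where "convex V" "0 \<in> interior V" "V \<subseteq> U"
  using convex_nhds_zero_base[OF assms] unfolding convex_def interior_def by blast

instance real_normed_vector < real_locally_convex
proof
  fix r :: real and a :: 'a
  show "LIM p (nhds r \<times>\<^sub>F nhds a). fst p *\<^sub>R snd p :> nhds (r *\<^sub>R a)"
    by (intro tendsto_scaleR filterlim_fst filterlim_snd)
next
  fix U :: "'a set"
  assume "open U" "0 \<in> U"
  then obtain e where "e > 0" "ball 0 e \<subseteq> U"
    by (meson open_contains_ball)
  then show "\<exists>V W. (\<forall>x\<in>V. \<forall>y\<in>V. \<forall>u\<ge>0. \<forall>v\<ge>0. u + v = 1 \<longrightarrow> u *\<^sub>R x + v *\<^sub>R y \<in> V) \<and>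
             open W \<and> 0 \<in> W \<and> W \<subseteq> V \<and> V \<subseteq> U"
    using convex_ball[of "0::'a" e] unfolding convex_def
    by (intro exI[of _ "ball 0 e"] conjI) auto
qed

definition self_segment_dense :: "'a::real_topological_vector set \<Rightarrow> 'a set \<Rightarrow> bool" where
  "self_segment_dense U V \<longleftrightarrow>
     U \<subseteq> V \<and> convex V \<and> V \<subseteq> closure U \<and>
     (\<forall>x\<in>U. \<forall>y\<in>U. closed_segment x y \<subseteq> closure (closed_segment x y \<inter> U))"

text \<open>
  \<open>f\<close> is regarded as a function on \<open>K\<close> only, so neighbourhoods are relative to \<open>K\<close> even when
  semicontinuity is asked just at the points of a smaller set \<open>S\<close>.
\<close>

definition usc_on :: "'a::topological_space set \<Rightarrow> ('a \<Rightarrow> real) \<Rightarrow> 'a set \<Rightarrow> bool" where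
  "usc_on K f S \<longleftrightarrow>
     S \<subseteq> K \<and> (\<forall>x\<in>S. \<forall>c. f x < c \<longrightarrow> (\<forall>\<^sub>F z in at x within K. f z < c))"

text \<open>
  The library's \<^const>\<open>convex_on\<close> requires a convex domain and only two-point combinations.
  On a nonconvex domain the condition has to be stated for combinations of arbitrary length.
\<close>

definition convex_fun_on :: "'a::real_vector set \<Rightarrow> ('a \<Rightarrow> real) \<Rightarrow> bool" where
  "convex_fun_on D f \<longleftrightarrow>
     (\<forall>(n::nat) (x :: nat \<Rightarrow> 'a) (l :: nat \<Rightarrow> real).
        (\<forall>i\<in>{1..n}. x i \<in> D \<and> 0 \<le> l i) \<and> (\<Sum>i=1..n. l i) = 1 \<and>
        (\<Sum>i=1..n. l i *\<^sub>R x i) \<in> D \<longrightarrow>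
        (\<Sum>i=1..n. l i * f (x i)) \<ge> f (\<Sum>i=1..n. l i *\<^sub>R x i))"

end

theory Submission
  imports Defs
begin

text \<open>
  The superlevel sets \<open>{x \<in> K. 0 \<le> \<phi> x y}\<close> with \<open>y \<in> D\<close> are closed, and convexity together with
  \<open>0 \<le> \<phi> x x\<close> shows that those of finitely many \<open>y\<^sub>i\<close> cover the points of \<open>D\<close> in the convex
  hull of the \<open>y\<^sub>i\<close>. Self segment-density makes these points dense in the hull, so the whole hull
  is covered. By the KKM lemma and compactness, all the superlevel sets have a common point
  \<open>x0\<close>, and upper semicontinuity off \<open>D\<close> transfers \<open>0 \<le> \<phi> x0 y\<close> from the dense set \<open>D\<close> to \<open>K\<close>.

  The KKM lemma is obtained from Kuhn's combinatorial lemma on the cube rather than from Brouwer's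
  theorem, whose library version fixes the dimension by a type. The stick-breaking map sends the
  cube onto the simplex in such a way that a KKM colour of a point is the reduced form of an
  admissible Kuhn labelling.
\<close>

section \<open>Stick-breaking coordinates and the KKM lemma\<close>

text \<open>The entry \<open>t i\<close> is the fraction broken off what the pieces before
  \<open>i\<close> have left. Piece \<open>n\<close> takes the whole remainder, hence its factor
  1.\<close>

definition stick :: "nat \<Rightarrow> (nat \<Rightarrow> real) \<Rightarrow> nat \<Rightarrow> real" where
  "stick n t i = (if i < n then t i else 1) * (\<Prod>j<i. 1 - t j)"

lemma sum_stick: "(\<Sum>i\<le>n. stick n t i) = 1"
proof -
  \<comment> \<open>The product is the length left after \<open>m\<close> pieces, so the sum
    telescopes.\<close>
  have "(\<Sum>i<m. t i * (\<Prod>j<i. 1 - t j)) = 1 - (\<Prod>j<m. 1 - t j)" for m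
    by (induction m) (auto simp: algebra_simps)
  moreover have "(\<Sum>i<n. stick n t i) = (\<Sum>i<n. t i * (\<Prod>j<i. 1 - t j))"
    by (intro sum.cong) (auto simp: stick_def)
  ultimately show ?thesis
    by (simp add: lessThan_Suc_atMost[symmetric] stick_def)
qed

lemma stick_nonneg:
  assumes "\<And>j. 0 \<le> t j \<and> t j \<le> 1"
  shows "0 \<le> stick n t i"
  using assms by (auto simp: stick_def intro!: mult_nonneg_nonneg prod_nonneg)

lemma tendsto_stick:
  assumes "\<And>j. ((\<lambda>k. t k j) \<longlongrightarrow> a j) F"
  shows "((\<lambda>k. stick n (t k) i) \<longlongrightarrow> stick n a i) F"
  unfolding stick_def using assms by (auto intro!: tendsto_intros)

text \<open>Kuhn's lemma on the grid of mesh \<open>1 / p\<close> yields a cell whose vertices carry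
  all colours. Its boundary conditions hold because a colour must be the index of a nonempty
  piece.\<close>

lemma small_cell_all_colours:
  fixes c :: "(nat \<Rightarrow> real) \<Rightarrow> nat"
  assumes c: "\<And>t. (\<And>j. 0 \<le> t j \<and> t j \<le> 1) \<Longrightarrow> c t \<le> n \<and> stick n t (c t) \<noteq> 0"
    and p: "0 < p"
  obtains b u where "\<And>j. 0 \<le> b j \<and> b j \<le> 1"
    and "\<And>i j. i \<le> n \<Longrightarrow> 0 \<le> u i j \<and> u i j \<le> 1 \<and> \<bar>u i j - b j\<bar> \<le> 1 / real p"
    and "\<And>i. i \<le> n \<Longrightarrow> c (u i) = i"
proof -
  define sc :: "(nat \<Rightarrow> nat) \<Rightarrow> nat \<Rightarrow> real" where "sc x = (\<lambda>j. real (x j) / real p)" for x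
  \<comment> \<open>\<open>reduced n\<close> returns the first index below \<open>n\<close> with a
    nonzero label, or else \<open>n\<close>. Labels 0 before the colour and 1 at it therefore reduce
    to the colour; the later labels are chosen to fit the two faces \<open>x i = 0\<close> and
    \<open>x i = p\<close>.\<close>
  define lab :: "(nat \<Rightarrow> nat) \<Rightarrow> nat \<Rightarrow> nat" where
    "lab x i = (if i = c (sc x) then 1 else if i < c (sc x) \<or> x i = 0 then 0 else 1)" for x i
  have sc: "0 \<le> sc x j \<and> sc x j \<le> 1" if "x j \<le> p" for x j
    using that p by (auto simp: sc_def)
  have c_sc: "c (sc x) \<le> n" "stick n (sc x) (c (sc x)) \<noteq> 0" if "\<And>j. x j \<le> p" for x
    using c[of "sc x"] sc that by auto
  have red: "reduced n (lab x) = c (sc x)" if "\<And>j. x j \<le> p" for x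
    using c_sc[of x, OF that] by (intro reduced_labelling_unique) (auto simp: lab_def)
  \<comment> \<open>On this face piece \<open>j\<close> is empty, so it is not the colour. This
    needs \<open>j < n\<close>, since piece \<open>n\<close> does not depend on
    \<open>t n\<close>.\<close>
  have 0: "lab x j = 0" if "\<And>j. x j \<le> p" "j < n" "x j = 0" for x j
  proof -
    have "sc x j = 0" using that by (simp add: sc_def)
    then have "j \<noteq> c (sc x)"
      using c_sc(2)[of x, OF that(1)] that(2) by (auto simp: stick_def)
    then show ?thesis using that by (auto simp: lab_def)
  qed
  \<comment> \<open>Piece \<open>j\<close> takes all that is left, so no later piece can be the
    colour.\<close>
  have 1: "lab x j = 1" if "\<And>j. x j \<le> p" "j < n" "x j = p" for x j
  proof -
    have "sc x j = 1" using that p by (simp add: sc_def)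
    then have "\<not> j < c (sc x)"
      using c_sc(2)[of x, OF that(1)] by (auto simp: stick_def)
    then show ?thesis using that p by (auto simp: lab_def)
  qed
  have "odd (card {s. ksimplex p n s \<and> (reduced n \<circ> lab) ` s = {..n}})"
    using p 0 1 by (intro kuhn_combinatorial) auto
  then have "{s. ksimplex p n s \<and> (reduced n \<circ> lab) ` s = {..n}} \<noteq> {}"
    by (rule odd_card_imp_not_empty)
  then obtain s b upd where "kuhn_simplex p n b upd s" and rl: "(reduced n \<circ> lab) ` s = {..n}"
    by (auto elim: ksimplex.cases)
  interpret kuhn_simplex p n b upd s by fact
  \<comment> \<open>Vertices of a Kuhn simplex have the constant value \<open>p\<close> in all
    coordinates from \<open>n\<close> on.\<close>
  have le_p: "x j \<le> p" if "x \<in> s" for x j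
    using s_space out_eq_p[OF that, of j] that by (cases "j < n") auto
  have "\<exists>x\<in>s. reduced n (lab x) = i" if "i \<le> n" for i
    using that rl by (metis (no_types, lifting) atMost_iff comp_apply imageE)
  then obtain v where v: "\<And>i. i \<le> n \<Longrightarrow> v i \<in> s \<and> reduced n (lab (v i)) = i"
    by metis
  show ?thesis
  proof
    show "0 \<le> sc b j \<and> sc b j \<le> 1" for j
      using sc[of b j, OF le_p[OF base_in_s]] .
    fix i assume i: "i \<le> n"
    show "c (sc (v i)) = i"
      using v[OF i] red[of "v i"] le_p[of "v i"] by simp
    fix j
    have "b j \<le> v i j" "v i j \<le> Suc (b j)"
      using v[OF i] base_le le_Suc_base by auto
    then have "\<bar>real (v i j) - real (b j)\<bar> \<le> 1"
      by auto
    then have "\<bar>sc (v i) j - sc b j\<bar> \<le> 1 / real p"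
      using p by (auto simp: sc_def diff_divide_distrib[symmetric] divide_right_mono)
    moreover have "v i j \<le> p"
      using le_p v[OF i] by blast
    ultimately show "0 \<le> sc (v i) j \<and> sc (v i) j \<le> 1 \<and> \<bar>sc (v i) j - sc b j\<bar> \<le> 1 / real p"
      using sc[of "v i" j] by simp
  qed
qed

text \<open>Tychonoff's theorem gives compactness; a countable product of real lines is first
  countable, so convergent subsequences exist.\<close>

lemma seq_compact_unit_cube: "seq_compact {t :: nat \<Rightarrow> real. \<forall>j. 0 \<le> t j \<and> t j \<le> 1}"
proof -
  have "compactin (product_topology (\<lambda>_. euclidean) UNIV) (PiE UNIV (\<lambda>_::nat. {0..1::real}))"
    by (simp add: compactin_PiE)
  moreover have "PiE UNIV (\<lambda>_::nat. {0..1::real}) = {t. \<forall>j. 0 \<le> t j \<and> t j \<le> 1}"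
    by (auto simp: PiE_def Pi_def)
  ultimately have "compact {t :: nat \<Rightarrow> real. \<forall>j. 0 \<le> t j \<and> t j \<le> 1}"
    by (simp add: euclidean_product_topology)
  then show ?thesis by (rule compact_imp_seq_compact)
qed

lemma tendsto_scaleR_tvs:
  fixes g :: "'b \<Rightarrow> 'a::real_topological_vector"
  assumes "(f \<longlongrightarrow> r) F" "(g \<longlongrightarrow> a) F"
  shows "((\<lambda>x. f x *\<^sub>R g x) \<longlongrightarrow> r *\<^sub>R a) F"
  using filterlim_compose[OF tendsto_scaleR_Pair filterlim_Pair[OF assms]] by simp

text \<open>A point of the cube is coloured by an index \<open>i\<close> of nonzero weight whose
  \<open>G i\<close> contains its image. Cells with all colours shrink to a point of the cube, and
  its image lies in every \<open>G i\<close> by closedness.\<close>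

lemma KKM:
  fixes y :: "nat \<Rightarrow> 'a::real_topological_vector"
  assumes closed: "\<And>i. i \<le> n \<Longrightarrow> closed (G i)"
    and cover: "\<And>I. I \<noteq> {} \<Longrightarrow> I \<subseteq> {..n} \<Longrightarrow> convex hull (y ` I) \<subseteq> (\<Union>i\<in>I. G i)"
  obtains z where "z \<in> convex hull (y ` {..n})" "\<And>i. i \<le> n \<Longrightarrow> z \<in> G i"
proof -
  define z where "z t = (\<Sum>i\<le>n. stick n t i *\<^sub>R y i)" for t
  define C :: "(nat \<Rightarrow> real) set" where "C = {t. \<forall>j. 0 \<le> t j \<and> t j \<le> 1}"
  have hull: "z t \<in> convex hull (y ` {i. i \<le> n \<and> stick n t i \<noteq> 0})" (is "_ \<in> convex hull (y ` ?I)")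
    if "t \<in> C" for t
  proof -
    have "z t = (\<Sum>i\<in>?I. stick n t i *\<^sub>R y i)"
      unfolding z_def by (intro sum.mono_neutral_right) auto
    also have "\<dots> \<in> convex hull (y ` ?I)"
    proof (rule convex_sum)
      have "(\<Sum>i\<in>?I. stick n t i) = (\<Sum>i\<le>n. stick n t i)"
        by (intro sum.mono_neutral_left) auto
      then show "(\<Sum>i\<in>?I. stick n t i) = 1" by (simp add: sum_stick)
    qed (use that in \<open>auto simp: C_def intro: stick_nonneg hull_inc\<close>)
    finally show ?thesis .
  qed
  \<comment> \<open>The covering hypothesis is applied to the face spanned by the indices of nonzero
    weight.\<close>
  have "\<exists>i\<le>n. stick n t i \<noteq> 0 \<and> z t \<in> G i" if "t \<in> C" for t
  proof -
    have "{i. i \<le> n \<and> stick n t i \<noteq> 0} \<noteq> {}"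
      using hull[OF that] by force
    then show ?thesis
      using cover[of "{i. i \<le> n \<and> stick n t i \<noteq> 0}"] hull[OF that] by blast
  qed
  then obtain c where c: "\<And>t. t \<in> C \<Longrightarrow> c t \<le> n \<and> stick n t (c t) \<noteq> 0 \<and> z t \<in> G (c t)"
    by metis
  have "\<exists>b u. b \<in> C \<and> (\<forall>i\<le>n. u i \<in> C \<and> c (u i) = i \<and> (\<forall>j. \<bar>u i j - b j\<bar> \<le> 1 / real (Suc k)))"
    for k
  proof (rule small_cell_all_colours)
    show "0 < Suc k" by simp
    fix t :: "nat \<Rightarrow> real"
    assume "\<And>j. 0 \<le> t j \<and> t j \<le> 1"
    then show "c t \<le> n \<and> stick n t (c t) \<noteq> 0"
      using c[of t] by (simp add: C_def)
  next
    fix b :: "nat \<Rightarrow> real" and u :: "nat \<Rightarrow> nat \<Rightarrow> real"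
    assume "\<And>j. 0 \<le> b j \<and> b j \<le> 1"
      and "\<And>i j. i \<le> n \<Longrightarrow> 0 \<le> u i j \<and> u i j \<le> 1 \<and> \<bar>u i j - b j\<bar> \<le> 1 / real (Suc k)"
      and "\<And>i. i \<le> n \<Longrightarrow> c (u i) = i"
    then show ?thesis
      unfolding C_def by (intro exI[of _ b] exI[of _ u]) simp
  qed
  then obtain b u where b: "\<And>k. b k \<in> C"
    and u: "\<And>k i. i \<le> n \<Longrightarrow> u k i \<in> C \<and> c (u k i) = i"
    and ub: "\<And>k i j. i \<le> n \<Longrightarrow> \<bar>u k i j - b k j\<bar> \<le> 1 / real (Suc k)"
    by metis
  obtain a r where a: "a \<in> C" and r: "strict_mono r" and lim: "(b \<circ> r) \<longlonglongrightarrow> a"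
    using seq_compactE[OF seq_compact_unit_cube, of b] b unfolding C_def by blast
  have b_lim: "(\<lambda>k. b (r k) j) \<longlonglongrightarrow> a j" for j
    using continuous_on_tendsto_compose[OF continuous_on_product_coordinates lim, of j] by simp
  \<comment> \<open>The mesh tends to 0, so along the subsequence the vertices of each colour share
    the limit of the base points.\<close>
  have u_lim: "(\<lambda>k. u (r k) i j) \<longlonglongrightarrow> a j" if "i \<le> n" for i j
  proof (rule Lim_transform[OF b_lim])
    have "(\<lambda>k. 1 / real (Suc (r k))) \<longlonglongrightarrow> 0"
      using LIMSEQ_subseq_LIMSEQ[OF LIMSEQ_inverse_real_of_nat r]
      by (simp add: o_def field_simps)
    then show "(\<lambda>k. u (r k) i j - b (r k) j) \<longlonglongrightarrow> 0"
      by (rule Lim_null_comparison[rotated]) (use ub that in auto)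
  qed
  show ?thesis
  proof
    show "z a \<in> convex hull (y ` {..n})"
      using hull[OF a] hull_mono[of "y ` {i. i \<le> n \<and> stick n a i \<noteq> 0}" "y ` {..n}"] by auto
    fix i assume i: "i \<le> n"
    have "(\<lambda>k. z (u (r k) i)) \<longlonglongrightarrow> z a"
      unfolding z_def
      by (intro tendsto_sum tendsto_scaleR_tvs tendsto_stick tendsto_const u_lim i)
    moreover have "z (u (r k) i) \<in> G i" for k
      using c u i by metis
    ultimately show "z a \<in> G i"
      using Lim_in_closed_set[OF closed[OF i], of "\<lambda>k. z (u (r k) i)" sequentially] by simp
  qed
qed

section \<open>Density of \<open>D\<close> in convex hulls of its finite subsets\<close>

text \<open>Induction on the generators. A point of the new hull lies between \<open>a\<close> and
  some \<open>w\<close> in the old hull; \<open>w\<close> is approximated by a point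
  \<open>v\<close> of \<open>D\<close>, and then self segment-density applies to the segment from
  \<open>a\<close> to \<open>v\<close>, whose ends are both in \<open>D\<close>.\<close>

lemma convex_hull_subset_closure_Int:
  fixes D :: "'a::real_topological_vector set"
  assumes D: "self_segment_dense D K" and "finite F" "F \<subseteq> D"
  shows "convex hull F \<subseteq> closure (convex hull F \<inter> D)"
  using \<open>finite F\<close> \<open>F \<subseteq> D\<close>
proof (induction F rule: finite_induct)
  case empty
  then show ?case by simp
next
  case (insert a F)
  show ?case
  proof (cases "F = {}")
    case True
    then show ?thesis using insert.prems closure_subset by force
  next
    case False
    show ?thesis
    proof
      fix x assume "x \<in> convex hull insert a F"
      then obtain s t w where st: "0 \<le> s" "0 \<le> t" "s + t = 1"
        and w: "w \<in> convex hull F" and x: "x = s *\<^sub>R a + t *\<^sub>R w"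
        unfolding convex_hull_insert[OF False] by auto
      show "x \<in> closure (convex hull insert a F \<inter> D)"
        unfolding closure_iff_nhds_not_empty
      proof (intro allI impI)
        fix A V assume V: "V \<subseteq> A" "open V" "x \<in> V"
        \<comment> \<open>Continuity turns closeness of \<open>v\<close> to \<open>w\<close> into
          membership of the combination in \<open>V\<close>.\<close>
        have "((\<lambda>v. s *\<^sub>R a + t *\<^sub>R v) \<longlongrightarrow> x) (nhds w)"
          unfolding x by (intro tendsto_add tendsto_scaleR_tvs tendsto_const tendsto_ident_at) (simp add: filterlim_ident)
        then have "eventually (\<lambda>v. s *\<^sub>R a + t *\<^sub>R v \<in> V) (nhds w)"
          using V topological_tendstoD by blast
        then obtain W where W: "open W" "w \<in> W" "\<And>v. v \<in> W \<Longrightarrow> s *\<^sub>R a + t *\<^sub>R v \<in> V"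
          unfolding eventually_nhds by blast
        have "w \<in> closure (convex hull F \<inter> D)"
          using insert w by auto
        then obtain v where v: "v \<in> W" "v \<in> convex hull F" "v \<in> D"
          using W unfolding closure_iff_nhds_not_empty by blast
        have "s = 1 - t" "t \<le> 1" using st by simp_all
        then have "s *\<^sub>R a + t *\<^sub>R v \<in> closed_segment a v"
          unfolding closed_segment_def using st(2) by blast
        then have "s *\<^sub>R a + t *\<^sub>R v \<in> closure (closed_segment a v \<inter> D)"
          using D v insert.prems unfolding self_segment_dense_def by blast
        then obtain d where d: "d \<in> V" "d \<in> closed_segment a v" "d \<in> D"
          using W(3)[OF v(1)] V unfolding closure_iff_nhds_not_empty by blast
        have "v \<in> convex hull insert a F"
          using v(2) hull_mono[of F "insert a F"] by blast
        then have "d \<in> convex hull insert a F"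
          using d(2) closed_segment_subset[of a "convex hull insert a F" v]
          by (auto simp: hull_inc)
        then show "convex hull insert a F \<inter> D \<inter> A \<noteq> {}"
          using d V by blast
      qed
    qed
  qed
qed

section \<open>Consequences of convexity and upper semicontinuity\<close>

text \<open>Were all values on \<open>S\<close> below \<open>f x\<close>, their weighted mean would
  be too, as some weight is positive; convexity forbids this.\<close>

lemma convex_fun_on_le_generator:
  assumes "convex_fun_on D f" "S \<subseteq> D" "x \<in> D" "x \<in> convex hull S"
  obtains v where "v \<in> S" "f x \<le> f v"
proof -
  obtain k u w where uw: "\<forall>i\<in>{1::nat..k}. 0 \<le> u i \<and> w i \<in> S" "sum u {1..k} = 1"
    and x: "(\<Sum>i=1..k. u i *\<^sub>R w i) = x"
    using assms(4) unfolding convex_hull_indexed by auto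
  have "f x \<le> (\<Sum>i=1..k. u i * f (w i))"
    using assms(1)[unfolded convex_fun_on_def, rule_format, of k w u] uw x assms(2,3) by auto
  moreover have "(\<Sum>i=1..k. u i * f (w i)) < (\<Sum>i=1..k. u i * f x)" if "\<forall>v\<in>S. f v < f x"
  proof (rule sum_strict_mono_ex1)
    show "\<forall>i\<in>{1..k}. u i * f (w i) \<le> u i * f x"
      using uw that by (auto intro!: mult_left_mono simp: less_imp_le)
    have "\<exists>i\<in>{1..k}. u i \<noteq> 0"
      using uw(2) by (metis sum.neutral zero_neq_one)
    then show "\<exists>i\<in>{1..k}. u i * f (w i) < u i * f x"
      using uw that by (metis mult_strict_left_mono order_le_less)
  qed simp
  ultimately show ?thesis
    using that uw(2) by (force simp: sum_distrib_right[symmetric])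
qed

lemma closed_usc_superlevel:
  assumes "closed K" "usc_on K f K"
  shows "closed {x \<in> K. c \<le> f x}"
  unfolding closed_def open_subopen[of "- _"]
proof (intro ballI)
  fix x assume "x \<in> - {x \<in> K. c \<le> f x}"
  show "\<exists>T. open T \<and> x \<in> T \<and> T \<subseteq> - {x \<in> K. c \<le> f x}"
  proof (cases "x \<in> K")
    case False
    then show ?thesis using assms(1) by (intro exI[of _ "- K"]) auto
  next
    case True
    with \<open>x \<in> - _\<close> have "f x < c" by auto
    then have "eventually (\<lambda>z. f z < c) (at x within K)"
      using assms(2) True unfolding usc_on_def by blast
    then obtain T where "open T" "x \<in> T" "\<forall>z\<in>T. z \<noteq> x \<longrightarrow> z \<in> K \<longrightarrow> f z < c"
      unfolding eventually_at_topological by blast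
    \<comment> \<open>The filter \<open>at x within K\<close> omits \<open>x\<close> itself, which
      \<open>f x < c\<close> handles.\<close>
    with \<open>f x < c\<close> show ?thesis by (intro exI[of _ T]) force
  qed
qed

theorem theorem3p4:
  fixes K D :: "'a::{real_locally_convex, t2_space} set"
    and \<phi> :: "'a \<Rightarrow> 'a \<Rightarrow> real"
  assumes "K \<noteq> {}" and "convex K" and "compact K"
    and "D \<subseteq> K" and "self_segment_dense D K"
    and "\<And>y. y \<in> D \<Longrightarrow> usc_on K (\<lambda>x. \<phi> x y) K"
    and "\<And>x. x \<in> K \<Longrightarrow> usc_on K (\<lambda>y. \<phi> x y) (K - D)"
    and "\<And>x. x \<in> D \<Longrightarrow> convex_fun_on D (\<lambda>y. \<phi> x y)"
    and "\<And>x. x \<in> D \<Longrightarrow> \<phi> x x \<ge> 0"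
  shows "\<exists>x0\<in>K. \<forall>y\<in>K. \<phi> x0 y \<ge> 0"
proof -
  define G where "G y = {x \<in> K. 0 \<le> \<phi> x y}" for y
  have closed_G: "closed (G y)" if "y \<in> D" for y
    \<comment> \<open>The Hausdorff property enters here: it makes the compact set \<open>K\<close>
      closed.\<close>
    unfolding G_def
    using closed_usc_superlevel[OF compact_imp_closed[OF \<open>compact K\<close>] assms(6)[OF that]] .
  have cover: "convex hull Y \<subseteq> (\<Union>y\<in>Y. G y)" if "finite Y" "Y \<subseteq> D" for Y
  proof -
    have "convex hull Y \<inter> D \<subseteq> (\<Union>y\<in>Y. G y)"
    proof
      fix x assume x: "x \<in> convex hull Y \<inter> D"
      then obtain v where "v \<in> Y" "\<phi> x x \<le> \<phi> x v"
        using convex_fun_on_le_generator[OF assms(8) \<open>Y \<subseteq> D\<close>, of x x] x by blast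
      moreover have "0 \<le> \<phi> x x" "x \<in> K" using x assms(4,9) by auto
      ultimately show "x \<in> (\<Union>y\<in>Y. G y)"
        unfolding G_def by fastforce
    qed
    \<comment> \<open>A finite union of closed sets is closed, so the covering extends to the
      closure and hence to the whole hull.\<close>
    then have "closure (convex hull Y \<inter> D) \<subseteq> (\<Union>y\<in>Y. G y)"
      using that closed_G by (intro closure_minimal closed_UN) auto
    then show ?thesis
      using convex_hull_subset_closure_Int[OF assms(5) that] by blast
  qed
  have "K \<inter> (\<Inter>y\<in>D. G y) \<noteq> {}"
  proof (rule compact_imp_fip_image[OF \<open>compact K\<close> closed_G])
    fix Y assume Y: "finite Y" "Y \<subseteq> D"
    show "K \<inter> (\<Inter>y\<in>Y. G y) \<noteq> {}"
    proof (cases "Y = {}")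
      case True
      then show ?thesis using \<open>K \<noteq> {}\<close> by simp
    next
      case False
      \<comment> \<open>KKM uses the indices \<open>0\<close> to \<open>m\<close>, so
        \<open>Y\<close> is enumerated with \<open>card Y = Suc m\<close>.\<close>
      then obtain m where m: "card Y = Suc m"
        using Y(1) by (metis card_0_eq not0_implies_Suc)
      obtain y where "bij_betw y {0..<card Y} Y"
        using ex_bij_betw_nat_finite[OF Y(1)] by blast
      then have y: "y ` {..m} = Y"
        by (simp add: m bij_betw_def atLeast0LessThan lessThan_Suc_atMost)
      obtain z where "z \<in> convex hull (y ` {..m})" and z: "\<And>i. i \<le> m \<Longrightarrow> z \<in> G (y i)"
      proof (rule KKM[of m "\<lambda>i. G (y i)" y])
        show "closed (G (y i))" if "i \<le> m" for i
          using that y Y(2) closed_G by blast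
        fix I assume I: "I \<subseteq> {..m}"
        then show "convex hull (y ` I) \<subseteq> (\<Union>i\<in>I. G (y i))"
          using cover[of "y ` I"] y Y finite_subset[of I] by auto
      qed (rule that)
      have "z \<in> (\<Inter>y\<in>Y. G y)" using z y by auto
      moreover have "z \<in> K" using z[of m] by (simp add: G_def)
      ultimately show ?thesis by blast
    qed
  qed
  then obtain x0 where x0: "x0 \<in> K" "\<And>y. y \<in> D \<Longrightarrow> 0 \<le> \<phi> x0 y"
    by (auto simp: G_def)
  have "0 \<le> \<phi> x0 y" if "y \<in> K - D" for y
  proof (rule ccontr)
    assume "\<not> 0 \<le> \<phi> x0 y"
    then have "eventually (\<lambda>z. \<phi> x0 z < 0) (at y within K)"
      using assms(7)[OF x0(1)] that unfolding usc_on_def by auto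
    then obtain T where T: "open T" "y \<in> T" "\<forall>z\<in>T. z \<noteq> y \<longrightarrow> z \<in> K \<longrightarrow> \<phi> x0 z < 0"
      unfolding eventually_at_topological by blast
    have "y \<in> closure D"
      using assms(5) that unfolding self_segment_dense_def by blast
    then obtain d where "d \<in> T" "d \<in> D"
      using T unfolding closure_iff_nhds_not_empty by blast
    \<comment> \<open>Here \<open>d\<close> differs from \<open>y\<close> because \<open>y\<close>
      is outside \<open>D\<close>, so the punctured neighbourhood contains it.\<close>
    then show False
      using T(3) x0(2)[of d] assms(4) that by force
  qed
  with x0 show ?thesis by blast
qed

end
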